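(* Let $n\in\mathbb{N}$, $n\ge 1$. Let $\mathcal{T}$ be a positive linear functional defined (at least) on the linear subspace of $\mathbb{R}^{[-1,1]}$ generated by the cone of all $2n$-convex functions $[-1,1]\to\mathbb{R}$. Assume that $\mathcal{T}$ is exact on $\Pi_{2n}$. If a function $f:[-1,1]\to\mathbb{R}$ is $2n$-convex, then $$\mathcal{R}^l_{n+1}(f)\le\mathcal{T}(f)\le\mathcal{R}^r_{n+1}(f).$$
   Context: Divided differences: $[x_1;f]:=f(x_1)$ and $[x_1,\dots,x_{k+1};f]:=\frac{[x_2,\dots,x_{k+1};f]-[x_1,\dots,x_k;f]}{x_{k+1}-x_1}$ for $k\ge 1$. For an integer $m\ge 1$, a function $f:I\to\mathbb{R}$ on an interval $I$ is $m$-convex if $[x_1,\dots,x_{m+2};f]\ge 0$ for all distinct $x_1,\dots,x_{m+2}\in I$ (so $1$-convexity is ordinary convexity; no differentiability or continuity is assumed). $\Pi_m$ is the space of real polynomials of degree at most $m$. $\mathcal{I}(f):=\int_{-1}^1 f(x)\,dx$. A real-valued linear functional $\mathcal{T}$ on a linear space $X$ of real functions is positive if $f\le g$ (pointwise) implies $\mathcal{T}(f)\le\mathcal{T}(g)$ for all $f,g\in X$. $\mathcal{T}$ is exact on $\Pi_m$ if $\mathcal{T}(p)=\mathcal{I}(p)$ for all $p\in\Pi_m$. $P_m$ is the Legendre polynomial of degree $m$ (standard normalization $P_m(1)=1$). Radau quadratures: for $m\ge 2$ and $f:[-1,1]\to\mathbb{R}$, $\mathcal{R}^l_m(f):=w_1f(-1)+\sum_{i=2}^m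 w_if(x_i)$, where $x_2,\dots,x_m$ are the roots of the polynomial $Q_{m-1}(x)=\frac{P_{m-1}(x)+P_m(x)}{x+1}$, $w_1=\frac{2}{m^2}$ and $w_i=\frac{1}{(1-x_i)[P_{m-1}'(x_i)]^2}$ for $2\le i\le m$. Further, $\mathcal{R}^r_m(f):=\mathcal{R}^l_m(\tilde f)$ where $\tilde f(x)=f(-x)$. *)

theory Defs
  imports
    "HOL-Analysis.Analysis"
    "HOL-Computational_Algebra.Polynomial"
    "HOL-Library.Function_Algebras"
begin

section \<open>The linear space of real functions\<close>

text \<open>
  A function on \<open>{-1..1}\<close> is represented by any total function that extends it.
  Convexity and the pointwise order below only look at values on \<open>{-1..1}\<close>; in particular
  a positive functional takes equal values on functions that agree on \<open>{-1..1}\<close>.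
\<close>

global_interpretation real_fun: vector_space "\<lambda>(c::real) (f :: real \<Rightarrow> real) x. c * f x"
  defines real_fun_subspace = real_fun.subspace
    and real_fun_span = real_fun.span
  by unfold_locales (auto simp: fun_eq_iff algebra_simps)

definition linear_functional_on :: "(real \<Rightarrow> real) set \<Rightarrow> ((real \<Rightarrow> real) \<Rightarrow> real) \<Rightarrow> bool" where
  "linear_functional_on X T \<longleftrightarrow>
     real_fun_subspace X \<and>
     (\<forall>f\<in>X. \<forall>g\<in>X. T (\<lambda>x. f x + g x) = T f + T g) \<and>
     (\<forall>c. \<forall>f\<in>X. T (\<lambda>x. c * f x) = c * T f)"

definition positive_functional_on :: "(real \<Rightarrow> real) set \<Rightarrow> ((real \<Rightarrow> real) \<Rightarrow> real) \<Rightarrow> bool" where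
  "positive_functional_on X T \<longleftrightarrow>
     (\<forall>f\<in>X. \<forall>g\<in>X. (\<forall>x\<in>{-1..1}. f x \<le> g x) \<longrightarrow> T f \<le> T g)"

definition exact_on_polys :: "nat \<Rightarrow> ((real \<Rightarrow> real) \<Rightarrow> real) \<Rightarrow> bool" where
  "exact_on_polys m T \<longleftrightarrow>
     (\<forall>p :: real poly. degree p \<le> m \<longrightarrow> T (poly p) = integral {-1..1} (poly p))"


section \<open>Divided differences and higher-order convexity\<close>

function divided_diff :: "(real \<Rightarrow> real) \<Rightarrow> real list \<Rightarrow> real" where
  "divided_diff f [] = 0"
| "divided_diff f [x] = f x"
| "divided_diff f (x # y # zs) =
     (divided_diff f (y # zs) - divided_diff f (x # butlast (y # zs))) / (last (y # zs) - x)"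
  by pat_completeness auto
termination by (relation "Wellfounded.measure (\<lambda>(f, xs). length xs)") auto

definition m_convex_on :: "nat \<Rightarrow> real set \<Rightarrow> (real \<Rightarrow> real) \<Rightarrow> bool" where
  "m_convex_on m I f \<longleftrightarrow>
     (\<forall>xs. length xs = m + 2 \<and> distinct xs \<and> set xs \<subseteq> I \<longrightarrow> divided_diff f xs \<ge> 0)"


section \<open>Legendre polynomials and Radau quadratures\<close>

text \<open>Rodrigues' formula, which gives the normalization \<open>P\<^sub>m(1) = 1\<close>.\<close>

definition legendre :: "nat \<Rightarrow> real poly" where
  "legendre m = smult (1 / (2 ^ m * fact m)) ((pderiv ^^ m) ([:-1, 0, 1:] ^ m))"

text \<open>The division is exact, since \<open>P\<^sub>k(-1) = (-1)\<^sup>k\<close>.\<close>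

definition radau_poly :: "nat \<Rightarrow> real poly" where
  "radau_poly m = (legendre (m - 1) + legendre m) div [:1, 1:]"

text \<open>For \<open>m \<ge> 2\<close>, the polynomial \<open>radau_poly m\<close> has exactly \<open>m - 1\<close> roots, all of
  them real and simple, so that summing over the set of its roots is summing over the nodes
  \<open>x\<^sub>2, \<dots>, x\<^sub>m\<close>.\<close>

definition radau_left :: "nat \<Rightarrow> (real \<Rightarrow> real) \<Rightarrow> real" where
  "radau_left m f =
     2 / (real m)\<^sup>2 * f (-1) +
     (\<Sum>x | poly (radau_poly m) x = 0.
        1 / ((1 - x) * (poly (pderiv (legendre (m - 1))) x)\<^sup>2) * f x)"

definition radau_right :: "nat \<Rightarrow> (real \<Rightarrow> real) \<Rightarrow> real" where
  "radau_right m f = radau_left m (\<lambda>x. f (- x))"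

end

theory Submission
  imports Defs
begin

text \<open>
  The lower bound is a one-sided approximation argument. The left Radau quadrature
  \<open>R\<close> with the nodes \<open>-1\<close> and \<open>z \<in> Z\<close>, where \<open>card Z = n\<close>, is exact for
  polynomials of degree at most \<open>2 n\<close> (\<open>radau_left_exact\<close>), as is \<open>T\<close>. If such a
  polynomial \<open>p\<close> lies below \<open>f\<close> and agrees with \<open>f\<close> at the nodes, then
  \<open>R f = R p = T p \<le> T f\<close>. The natural candidate interpolates \<open>f\<close> at \<open>-1\<close> once
  and at each \<open>z\<close> twice: the error is then a divided difference with \<open>2 n + 2\<close> nodes, which is
  nonnegative, times \<open>(x + 1)\<close> times a square.

  Double nodes would need a derivative of \<open>f\<close>. Instead, \<open>f\<close> is interpolated at \<open>z\<close>
  and \<open>z + \<epsilon>\<close>. The error can then have the wrong sign only between these two points, and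
  it is \<open>O(\<epsilon>)\<close> there (\<open>near_double_interpolant_below\<close>), because divided differences
  with \<open>2 n + 1\<close> nodes are monotone in each node (\<open>divided_diff_set_mono\<close>) and therefore
  bounded. Since the interpolant still agrees with \<open>f\<close> at the nodes of \<open>R\<close>, its integral is exactly
  \<open>R f\<close>, and letting \<open>\<epsilon>\<close> tend to zero gives \<open>R f \<le> T f\<close>
  (\<open>radau_left_le\<close>). The upper bound follows by applying this to \<open>x \<mapsto> - f (- x)\<close>, which is
  \<open>2 n\<close>-convex because \<open>2 n\<close> is even.

  The exactness of \<open>R\<close> with its explicit weights rests on the classical identities for
  Legendre polynomials, derived here from Rodrigues' formula. Orthogonality gives \<open>n\<close> simple roots
  inside the interval and exactness with some weights; testing with
  \<open>(P_n + P_(n+1)) P_n / (x - z)\<close> identifies these (\<open>radau_weight_identity\<close>).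
\<close>

section \<open>Divided differences over sets of nodes\<close>

text \<open>
  The expanded form of the divided difference. Being a sum over a set, it does not depend on the
  order of the nodes, so that any two of them can serve as the end points of the recurrence.
\<close>

definition divided_diff_set :: "(real \<Rightarrow> real) \<Rightarrow> real set \<Rightarrow> real" where
  "divided_diff_set f S = (\<Sum>x\<in>S. f x / (\<Prod>y\<in>S - {x}. x - y))"

lemma divided_diff_set_insert:
  assumes "finite S" "a \<notin> S"
  shows "divided_diff_set f (insert a S) =
    f a / (\<Prod>y\<in>S. a - y) + (\<Sum>x\<in>S. f x / ((x - a) * (\<Prod>y\<in>S - {x}. x - y)))"
proof -
  have "(\<Prod>y\<in>insert a S - {x}. x - y) = (x - a) * (\<Prod>y\<in>S - {x}. x - y)" if "x \<in> S" for x
  proof -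
    have "insert a S - {x} = insert a (S - {x})" using that assms by auto
    then show ?thesis using assms by simp
  qed
  then show ?thesis
    using assms by (simp add: divided_diff_set_def)
qed

text \<open>
  Partial fractions: \<open>(b - a) / ((x - a) * (x - b)) = 1 / (x - b) - 1 / (x - a)\<close> at each common node.
\<close>

lemma divided_diff_set_recurrence:
  assumes "finite S" "a \<notin> S" "b \<notin> S" "a \<noteq> b"
  shows "divided_diff_set f (insert a (insert b S)) * (b - a)
    = divided_diff_set f (insert b S) - divided_diff_set f (insert a S)"
proof -
  let ?w = "\<lambda>x. \<Prod>y\<in>S - {x}. x - y"
  have rest: "(\<Prod>y\<in>insert b S - {x}. x - y) = (x - b) * ?w x" if "x \<in> S" for x
  proof -
    have "insert b S - {x} = insert b (S - {x})" using that assms by auto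
    then show ?thesis using assms by simp
  qed
  have b: "insert b S - {b} = S" using assms by auto
  have "divided_diff_set f (insert a (insert b S)) =
      f a / ((a - b) * (\<Prod>y\<in>S. a - y)) + (f b / ((b - a) * (\<Prod>y\<in>S. b - y))
        + (\<Sum>x\<in>S. f x / ((x - a) * ((x - b) * ?w x))))"
    using assms by (subst divided_diff_set_insert) (auto simp: rest b)
  moreover have "f a / ((a - b) * c) * (b - a) = - (f a / c)" for c
  proof -
    have "b - a = - (a - b)" by simp
    with assms(4) show ?thesis by (simp only: mult_minus_right) simp
  qed
  moreover have "f b / ((b - a) * c) * (b - a) = f b / c" for c
    using assms(4) by simp
  moreover have "f x / ((x - a) * ((x - b) * ?w x)) * (b - a)
      = f x / ((x - b) * ?w x) - f x / ((x - a) * ?w x)" if "x \<in> S" for x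
  proof -
    have "x \<noteq> a" "x \<noteq> b" "?w x \<noteq> 0" using that assms by auto
    then show ?thesis by (simp add: divide_simps) (simp add: algebra_simps)
  qed
  ultimately show ?thesis
    using assms by (simp add: divided_diff_set_insert distrib_right sum_distrib_right sum_subtractf)
qed

lemma divided_diff_eq_divided_diff_set:
  "distinct xs \<Longrightarrow> divided_diff f xs = divided_diff_set f (set xs)"
proof (induction f xs rule: divided_diff.induct)
  case (3 f x y zs)
  define b where "b = last (y # zs)"
  define ms where "ms = butlast (y # zs)"
  have yzs: "y # zs = ms @ [b]"
    by (simp add: b_def ms_def del: last.simps butlast.simps)
  have d: "distinct ms" "b \<notin> set ms" "x \<notin> set ms" "x \<noteq> b"
    using "3.prems" unfolding yzs by auto
  have "divided_diff f (y # zs) = divided_diff_set f (insert b (set ms))"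
    using "3.IH"(1) d unfolding yzs by simp
  moreover have "divided_diff f (x # ms) = divided_diff_set f (insert x (set ms))"
    using "3.IH"(2) d unfolding ms_def[symmetric] by simp
  moreover have "set (x # y # zs) = insert x (insert b (set ms))"
    unfolding yzs by auto
  moreover have "divided_diff_set f (insert x (insert b (set ms)))
      = (divided_diff_set f (insert b (set ms)) - divided_diff_set f (insert x (set ms))) / (b - x)"
    using divided_diff_set_recurrence[of "set ms" x b f] d by (simp add: eq_divide_eq)
  ultimately show ?case
    by (simp only: divided_diff.simps b_def ms_def)
qed (simp_all add: divided_diff_set_def)

lemma m_convex_on_iff_divided_diff_set:
  "m_convex_on m I f \<longleftrightarrow>
     (\<forall>S. finite S \<and> card S = m + 2 \<and> S \<subseteq> I \<longrightarrow> divided_diff_set f S \<ge> 0)"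
proof
  assume f: "m_convex_on m I f"
  show "\<forall>S. finite S \<and> card S = m + 2 \<and> S \<subseteq> I \<longrightarrow> divided_diff_set f S \<ge> 0"
  proof (intro allI impI)
    fix S assume S: "finite S \<and> card S = m + 2 \<and> S \<subseteq> I"
    then obtain xs where "set xs = S" "distinct xs" using finite_distinct_list by blast
    then show "divided_diff_set f S \<ge> 0"
      using f S divided_diff_eq_divided_diff_set[of xs f] distinct_card[of xs] by (auto simp: m_convex_on_def)
  qed
qed (auto simp: m_convex_on_def divided_diff_eq_divided_diff_set distinct_card)

text \<open>
  Each of the \<open>card S - 1\<close> factors of a denominator changes its sign, and so does the value of the
  function. For an even order of convexity, this makes \<open>x \<mapsto> - f (- x)\<close> convex of that
  order when \<open>f\<close> is, which exchanges the left and the right quadrature.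
\<close>

lemma divided_diff_set_reflect:
  "divided_diff_set (\<lambda>x. - f (- x)) S = (- 1) ^ card S * divided_diff_set f (uminus ` S)"
proof (cases "finite S")
  case True
  have "- f (- x) / (\<Prod>y\<in>S - {x}. x - y)
      = (- 1) ^ card S * (f (- x) / (\<Prod>y\<in>uminus ` S - {- x}. - x - y))" if "x \<in> S" for x
  proof -
    have "uminus ` S - {- x} = uminus ` (S - {x})" by auto
    then have "(\<Prod>y\<in>uminus ` S - {- x}. - x - y) = (\<Prod>y\<in>S - {x}. - 1 * (x - y))"
      by (simp add: prod.reindex)
    also have "\<dots> = (- 1) ^ (card S - 1) * (\<Prod>y\<in>S - {x}. x - y)"
      using that True by (simp only: prod.distrib prod_constant card_Diff_singleton)
    also have "(- 1 :: real) ^ (card S - 1) = - ((- 1) ^ card S)"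
      using that True by (cases "card S") auto
    finally show ?thesis
      by (cases "even (card S)") auto
  qed
  then show ?thesis
    by (simp add: divided_diff_set_def sum_distrib_left sum.reindex)
qed (auto simp: divided_diff_set_def finite_image_iff inj_on_def)

lemma m_convex_on_reflect:
  assumes "even m" "m_convex_on m {-1..1} f"
  shows "m_convex_on m {-1..1} (\<lambda>x. - f (- x))"
  unfolding m_convex_on_iff_divided_diff_set
proof (intro allI impI)
  fix S :: "real set"
  assume S: "finite S \<and> card S = m + 2 \<and> S \<subseteq> {-1..1}"
  then have "card (uminus ` S) = m + 2" "finite (uminus ` S)" "uminus ` S \<subseteq> {-1..1}"
    by (auto simp: card_image)
  then show "divided_diff_set (\<lambda>x. - f (- x)) S \<ge> 0"
    using assms S by (simp add: divided_diff_set_reflect m_convex_on_iff_divided_diff_set)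
qed

text \<open>
  The derivative-free form of "the derivative of order \<open>m\<close> is increasing". The nodes of
  \<open>S\<close> are exchanged for those of \<open>V\<close> one at a time, and by the recurrence each
  exchange adds a positive multiple of a divided difference with \<open>m + 2\<close> nodes.
\<close>

lemma divided_diff_set_mono:
  assumes "m_convex_on m I f"
    and "finite B" "finite S" "finite V" "card S = card V" "card (B \<union> S) = m + 1"
    and "B \<inter> S = {}" "B \<inter> V = {}" "B \<union> S \<union> V \<subseteq> I" "\<And>s v. s \<in> S \<Longrightarrow> v \<in> V \<Longrightarrow> s < v"
  shows "divided_diff_set f (B \<union> S) \<le> divided_diff_set f (B \<union> V)"
  using assms(3,2,4-)
proof (induction S arbitrary: B V rule: finite_induct)
  case empty
  then show ?case by simp
next
  case (insert s S)
  obtain v V' where V: "V = insert v V'" "v \<notin> V'" "finite V'"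
    using insert by (metis card_eq_SucD card_insert_disjoint finite_insert)
  have sv: "s < v" "\<And>t. t \<in> S \<Longrightarrow> t < v" using insert.prems V by auto
  then have nin: "s \<notin> B \<union> S" "v \<notin> B \<union> S" "s \<noteq> v"
    using insert.prems insert.hyps V by auto
  have card: "card (insert s (B \<union> S)) = m + 1" using insert.prems(4) by simp
  then have card': "card (B \<union> S) = m"
    using nin insert by simp
  have "0 \<le> divided_diff_set f (insert s (insert v (B \<union> S)))"
    using assms(1) nin card' insert V
    unfolding m_convex_on_iff_divided_diff_set by auto
  then have "divided_diff_set f (insert s (B \<union> S)) \<le> divided_diff_set f (insert v (B \<union> S))"
    using divided_diff_set_recurrence[of "B \<union> S" s v f] nin insert sv(1)
    by (metis (no_types, lifting) diff_ge_0_iff_ge finite_Un less_eq_real_def mult_nonneg_nonneg)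
  also have "insert v (B \<union> S) = insert v B \<union> S" by simp
  also have "divided_diff_set f (insert v B \<union> S) \<le> divided_diff_set f (insert v B \<union> V')"
    using insert.prems insert.hyps V nin sv card' by (intro insert.IH) auto
  finally show ?case using V by simp
qed

section \<open>Lagrange interpolation\<close>

definition nodal_poly :: "real set \<Rightarrow> real poly" where
  "nodal_poly S = (\<Prod>t\<in>S. [:- t, 1:])"

lemma poly_nodal_poly: "poly (nodal_poly S) x = (\<Prod>t\<in>S. x - t)"
  by (simp add: nodal_poly_def poly_prod)

lemma nodal_poly_nonzero [simp]: "nodal_poly S \<noteq> 0"
  by (cases "finite S") (simp_all add: nodal_poly_def)

lemma degree_nodal_poly: "degree (nodal_poly S) = card S"
proof (cases "finite S")
  case True
  then show ?thesis
    unfolding nodal_poly_def by (subst degree_prod_eq_sum_degree) auto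
qed (simp add: nodal_poly_def)

lemma coeff_nodal_poly: "coeff (nodal_poly S) (card S) = 1"
proof -
  have "lead_coeff (nodal_poly S) = 1"
    by (simp add: nodal_poly_def lead_coeff_prod)
  then show ?thesis by (simp add: degree_nodal_poly)
qed

lemma nodal_poly_remove:
  "finite S \<Longrightarrow> t \<in> S \<Longrightarrow> nodal_poly S = [:- t, 1:] * nodal_poly (S - {t})"
  by (simp add: nodal_poly_def prod.remove)

lemma nodal_poly_dvd:
  assumes "finite S" "\<And>t. t \<in> S \<Longrightarrow> poly p t = 0"
  shows "nodal_poly S dvd p"
  using assms
proof (induction S arbitrary: p rule: finite_induct)
  case (insert t S)
  from insert.prems have "[:- t, 1:] dvd p" by (simp add: poly_eq_0_iff_dvd)
  then obtain q where q: "p = [:- t, 1:] * q" by (elim dvdE)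
  have "nodal_poly S dvd q"
  proof (rule insert.IH)
    fix s assume "s \<in> S"
    then have "poly p s = 0" "s \<noteq> t" using insert by auto
    then show "poly q s = 0" by (simp add: q)
  qed
  then show ?case
    using insert.hyps by (auto simp: q nodal_poly_def intro: mult_dvd_mono simp del: mult_pCons_left)
qed (simp add: nodal_poly_def)

definition lagrange_basis :: "real set \<Rightarrow> real \<Rightarrow> real poly" where
  "lagrange_basis S s = smult (1 / (\<Prod>t\<in>S - {s}. s - t)) (nodal_poly (S - {s}))"

definition interpolant :: "(real \<Rightarrow> real) \<Rightarrow> real set \<Rightarrow> real poly" where
  "interpolant f S = (\<Sum>s\<in>S. smult (f s) (lagrange_basis S s))"

lemma degree_interpolant:
  assumes "finite S" "card S \<le> Suc k"
  shows "degree (interpolant f S) \<le> k"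
  unfolding interpolant_def
proof (rule degree_sum_le[OF assms(1)])
  fix s assume "s \<in> S"
  then have "card (S - {s}) \<le> k" using assms by simp
  then show "degree (smult (f s) (lagrange_basis S s)) \<le> k"
    by (simp add: lagrange_basis_def degree_nodal_poly)
qed

lemma poly_lagrange_basis:
  assumes "finite S" "s \<in> S" "x \<in> S"
  shows "poly (lagrange_basis S s) x = (if x = s then 1 else 0)"
proof (cases "x = s")
  case True
  then show ?thesis using assms by (simp add: lagrange_basis_def poly_nodal_poly)
next
  case False
  then have "(\<Prod>t\<in>S - {s}. x - t) = 0" using assms by (intro prod_zero) auto
  with False show ?thesis by (simp add: lagrange_basis_def poly_nodal_poly)
qed

lemma poly_interpolant:
  assumes "finite S" "x \<in> S"
  shows "poly (interpolant f S) x = f x"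
  using assms by (simp add: interpolant_def poly_sum poly_lagrange_basis if_distrib[of "(*) _"] cong: if_cong)

text \<open>
  In the expanded form of the divided difference, the node polynomial at \<open>x\<close> turns the term of
  \<open>x\<close> into \<open>f x\<close> and the other terms into those of Lagrange's formula, with a minus sign.
\<close>

lemma interpolation_error:
  assumes "finite S" "x \<notin> S"
  shows "f x - poly (interpolant f S) x = divided_diff_set f (insert x S) * (\<Prod>t\<in>S. x - t)"
proof -
  let ?W = "\<Prod>t\<in>S. x - t"
  have W: "?W \<noteq> 0" using assms by auto
  have "f s / ((s - x) * (\<Prod>y\<in>S - {s}. s - y)) * ?W = - (f s * poly (lagrange_basis S s) x)"
    if "s \<in> S" for s
  proof -
    have "?W = (x - s) * (\<Prod>t\<in>S - {s}. x - t)" using that assms by (simp add: prod.remove)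
    moreover have "x \<noteq> s" "(\<Prod>y\<in>S - {s}. s - y) \<noteq> 0" using that assms by auto
    ultimately show ?thesis
      by (simp add: lagrange_basis_def poly_nodal_poly divide_simps) (simp add: algebra_simps)
  qed
  then show ?thesis
    using assms W
    by (simp add: divided_diff_set_insert interpolant_def poly_sum distrib_right sum_distrib_right sum_negf)
qed

lemma interpolant_poly:
  assumes "finite S" "degree p < card S"
  shows "interpolant (poly p) S = p"
proof (rule poly_eqI_degree[of S])
  show "degree (interpolant (poly p) S) < card S"
    using assms degree_interpolant[of S "card S - 1" "poly p"] by linarith
qed (use assms in \<open>auto simp: poly_interpolant\<close>)

text \<open>
  A polynomial of degree at most \<open>m\<close> is its own interpolant at \<open>m + 1\<close> nodes, so the
  interpolation error at any further point vanishes, and with it the divided difference.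
\<close>

lemma m_convex_on_poly:
  assumes "degree p \<le> m"
  shows "m_convex_on m I (poly p)"
  unfolding m_convex_on_iff_divided_diff_set
proof (intro allI impI)
  fix S assume S: "finite S \<and> card S = m + 2 \<and> S \<subseteq> I"
  then obtain x S' where S': "S = insert x S'" "x \<notin> S'" "finite S'"
    by (metis add_2_eq_Suc' card_eq_SucD card_ge_0_finite finite_insert zero_less_Suc)
  then have "interpolant (poly p) S' = p"
    using S assms by (intro interpolant_poly) auto
  then have "divided_diff_set (poly p) S * (\<Prod>t\<in>S'. x - t) = 0"
    using interpolation_error[of S' x "poly p"] S' by simp
  moreover have "(\<Prod>t\<in>S'. x - t) \<noteq> 0" using S' by auto
  ultimately show "divided_diff_set (poly p) S \<ge> 0" by simp
qed

section \<open>Integrals of polynomials\<close>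

definition poly_integral :: "real poly \<Rightarrow> real" where
  "poly_integral p = integral {-1..1} (poly p)"

lemma poly_integrable: "poly p integrable_on {-1..1::real}"
  by (intro integrable_continuous_real continuous_intros)

lemma poly_integral_0 [simp]: "poly_integral 0 = 0"
proof -
  have "poly (0 :: real poly) = (\<lambda>x. 0)" by auto
  then show ?thesis by (simp add: poly_integral_def)
qed

lemma poly_integral_add: "poly_integral (p + q) = poly_integral p + poly_integral q"
proof -
  have "poly (p + q) = (\<lambda>x. poly p x + poly q x)" by auto
  then show ?thesis
    unfolding poly_integral_def
    using integral_add[OF poly_integrable[of p] poly_integrable[of q]] by simp
qed

lemma poly_integral_smult: "poly_integral (smult c p) = c * poly_integral p"
proof -
  have "poly (smult c p) = (\<lambda>x. c * poly p x)" by auto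
  then show ?thesis by (simp add: poly_integral_def)
qed

lemma poly_integral_sum: "finite A \<Longrightarrow> poly_integral (\<Sum>a\<in>A. g a) = (\<Sum>a\<in>A. poly_integral (g a))"
  by (induction A rule: finite_induct) (simp_all add: poly_integral_add)

lemma poly_integral_pderiv: "poly_integral (pderiv F) = poly F 1 - poly F (- 1)"
  unfolding poly_integral_def
  by (intro integral_unique fundamental_theorem_of_calculus)
     (auto simp: has_real_derivative_iff_has_vector_derivative[symmetric]
       intro: has_field_derivative_at_within poly_DERIV)

lemma poly_integral_pos:
  assumes "\<And>x. x \<in> {-1..1} \<Longrightarrow> poly p x \<ge> 0" "p \<noteq> 0"
  shows "poly_integral p > 0"
proof (rule ccontr)
  assume "\<not> poly_integral p > 0"
  moreover have "poly_integral p \<ge> 0"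
    unfolding poly_integral_def using assms by (intro integral_nonneg poly_integrable) auto
  ultimately have "poly_integral p = 0" by simp
  then have "(poly p has_integral 0) (cbox (-1) 1)"
    using integrable_integral[OF poly_integrable, of p] by (simp add: poly_integral_def)
  moreover have "continuous_on {-1..1} (poly p)" by (intro continuous_intros)
  ultimately have "poly p x = 0" if "x \<in> {-1..1}" for x
    using has_integral_0_cbox_imp_0[of "-1" 1 "poly p" x] assms(1) that
    by auto
  then have "{-1..1} \<subseteq> {x. poly p x = 0}" by auto
  then have "finite {-1..1::real}" using assms(2) poly_roots_finite finite_subset by blast
  then show False using infinite_Icc[of "-1::real" 1] by simp
qed

lemma poly_eqI_poly: "(\<And>x. poly p x = poly q x) \<Longrightarrow> p = (q :: real poly)"
  using poly_eq_poly_eq_iff by blast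

section \<open>Legendre polynomials\<close>

text \<open>
  Two cases of the Leibniz rule. The factors are kept abstract, with only their derivatives known,
  so that their coefficients never enter; they are \<open>x\<close> and \<open>x^2 - 1\<close> below.
\<close>

lemma pderiv_funpow_mult_linear:
  fixes x q :: "real poly"
  assumes "pderiv x = 1"
  shows "(pderiv ^^ Suc k) (x * q) = x * (pderiv ^^ Suc k) q + of_nat (Suc k) * (pderiv ^^ k) q"
  using assms
  by (induction k) (simp_all add: pderiv_add pderiv_mult pderiv_of_nat algebra_simps)

lemma pderiv_funpow_mult_quadratic_pderiv:
  fixes x u q :: "real poly"
  assumes "pderiv x = 1" "pderiv u = x + x"
  shows "(pderiv ^^ Suc k) (u * pderiv q) =
     u * (pderiv ^^ Suc (Suc k)) q + of_nat (2 * Suc k) * x * (pderiv ^^ Suc k) q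
     + of_nat (Suc k * k) * (pderiv ^^ k) q"
  using assms
  by (induction k) (simp_all add: pderiv_add pderiv_mult pderiv_of_nat algebra_simps)

lemma pderiv_quadratic_power_Suc:
  fixes x u :: "real poly"
  assumes "pderiv u = x + x"
  shows "pderiv (u ^ Suc m) = smult (2 * real (Suc m)) (x * u ^ m)"
  unfolding pderiv_power_Suc assms
  by (rule poly_eqI_poly) (simp del: of_nat_Suc)

lemma quadratic_times_pderiv_power:
  fixes x u :: "real poly"
  assumes "pderiv u = x + x"
  shows "u * pderiv (u ^ m) = smult (2 * real m) (x * u ^ m)"
proof (cases m)
  case (Suc k)
  show ?thesis
    unfolding Suc pderiv_quadratic_power_Suc[OF assms] by (simp add: ac_simps)
qed simp

abbreviation "\<X> \<equiv> [:0, 1:] :: real poly"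
abbreviation "\<U> \<equiv> [:-1, 0, 1:] :: real poly"

lemma pderiv_XU: "pderiv \<X> = 1" "pderiv \<U> = \<X> + \<X>"
  by (simp_all add: pderiv_pCons one_pCons)

lemma poly_higher_pderiv_legendre:
  "poly ((pderiv ^^ j) (legendre m)) x = poly ((pderiv ^^ (j + m)) (\<U> ^ m)) x / (2 ^ m * fact m)"
  unfolding legendre_def higher_pderiv_smult funpow_add o_apply poly_smult by simp

text \<open>
  Differentiate \<open>((x^2 - 1)^(m + 1))' = 2 (m + 1) x (x^2 - 1)^m\<close> a further \<open>m + 1\<close> times.
\<close>

lemma pderiv_legendre_Suc:
  "poly (pderiv (legendre (Suc m))) x =
     x * poly (pderiv (legendre m)) x + real (Suc m) * poly (legendre m) x"
proof -
  define E where "E k = poly ((pderiv ^^ k) (\<U> ^ m)) x" for k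
  define F where "F = poly ((pderiv ^^ Suc (Suc m)) (\<U> ^ Suc m)) x"
  have "F = poly ((pderiv ^^ Suc m) (smult (2 * real (Suc m)) (\<X> * \<U> ^ m))) x"
    unfolding F_def funpow_Suc_right o_apply pderiv_quadratic_power_Suc[OF pderiv_XU(2)] ..
  also have "\<dots> = 2 * real (Suc m) * (x * E (Suc m) + real (Suc m) * E m)"
    unfolding higher_pderiv_smult pderiv_funpow_mult_linear[OF pderiv_XU(1)] E_def
    by (simp only: poly_smult poly_add poly_mult poly_of_nat) simp
  finally have F: "F / (2 ^ Suc m * fact (Suc m))
      = (x * E (Suc m) + real (Suc m) * E m) / (2 ^ m * fact m)"
    by (simp add: divide_simps del: of_nat_Suc)
  have "poly (pderiv (legendre (Suc m))) x = F / (2 ^ Suc m * fact (Suc m))"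
    using poly_higher_pderiv_legendre[of 1 "Suc m" x] unfolding F_def One_nat_def add_Suc add_0 by simp
  moreover have "poly (pderiv (legendre m)) x = E (Suc m) / (2 ^ m * fact m)"
    using poly_higher_pderiv_legendre[of 1 m x] unfolding E_def One_nat_def add_Suc add_0 by simp
  moreover have "poly (legendre m) x = E m / (2 ^ m * fact m)"
    using poly_higher_pderiv_legendre[of 0 m x] unfolding E_def by simp
  ultimately show ?thesis by (simp only: F add_divide_distrib times_divide_eq_right)
qed

text \<open>
  The power \<open>v = (x^2 - 1)^m\<close> satisfies \<open>(x^2 - 1) v' = 2 m x v\<close>; differentiate this
  \<open>m + 1\<close> times.
\<close>

lemma legendre_ode:
  "(x\<^sup>2 - 1) * poly (pderiv (pderiv (legendre m))) x + 2 * x * poly (pderiv (legendre m)) x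
     = real (m * (m + 1)) * poly (legendre m) x"
proof -
  define E where "E k = poly ((pderiv ^^ k) (\<U> ^ m)) x" for k
  have "(x\<^sup>2 - 1) * E (Suc (Suc m)) + real (2 * Suc m) * x * E (Suc m) + real (Suc m * m) * E m
    = poly ((pderiv ^^ Suc m) (\<U> * pderiv (\<U> ^ m))) x"
    unfolding pderiv_funpow_mult_quadratic_pderiv[OF pderiv_XU] E_def poly_add poly_mult poly_of_nat
    by (simp add: power2_eq_square)
  also have "\<dots> = 2 * real m * (x * E (Suc m) + real (Suc m) * E m)"
    unfolding quadratic_times_pderiv_power[OF pderiv_XU(2)] higher_pderiv_smult
      pderiv_funpow_mult_linear[OF pderiv_XU(1)] E_def
    by (simp only: poly_smult poly_add poly_mult poly_of_nat) simp
  finally have ode: "(x\<^sup>2 - 1) * E (Suc (Suc m)) + 2 * x * E (Suc m) = real (m * (m + 1)) * E m"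
    by (simp add: algebra_simps)
  have "poly (pderiv (pderiv (legendre m))) x = E (Suc (Suc m)) / (2 ^ m * fact m)"
    using poly_higher_pderiv_legendre[of 2 m x] unfolding E_def numeral_2_eq_2 add_Suc add_0 by simp
  moreover have "poly (pderiv (legendre m)) x = E (Suc m) / (2 ^ m * fact m)"
    using poly_higher_pderiv_legendre[of 1 m x] unfolding E_def One_nat_def add_Suc add_0 by simp
  moreover have "poly (legendre m) x = E m / (2 ^ m * fact m)"
    using poly_higher_pderiv_legendre[of 0 m x] unfolding E_def by simp
  ultimately show ?thesis
    by (simp only: times_divide_eq_right add_divide_distrib[symmetric] ode)
qed

lemma pderiv_legendre_at:
  assumes "x\<^sup>2 = 1"
  shows "2 * x * poly (pderiv (legendre m)) x = real (m * (m + 1)) * poly (legendre m) x"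
  using legendre_ode[of x m] unfolding assms by simp

lemma legendre_0 [simp]: "legendre 0 = 1"
  by (simp add: legendre_def)

text \<open>
  At the end points the coefficient \<open>x^2 - 1\<close> of the differential equation vanishes, which
  expresses the derivative by the value there; the derivative recurrence then becomes a recurrence
  for the values.
\<close>

lemma legendre_at_unit:
  assumes "x\<^sup>2 = 1"
  shows "poly (legendre m) x = x ^ m"
proof (induction m)
  case (Suc m)
  have "real (Suc m * (Suc m + 1)) * poly (legendre (Suc m)) x
      = 2 * x * (x * poly (pderiv (legendre m)) x + real (Suc m) * poly (legendre m) x)"
    using pderiv_legendre_at[OF assms, of "Suc m"] by (simp only: pderiv_legendre_Suc)
  also have "\<dots> = x * (2 * x * poly (pderiv (legendre m)) x) + 2 * x * (real (Suc m) * poly (legendre m) x)"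
    by (simp add: algebra_simps)
  also have "\<dots> = real (Suc m * (Suc m + 1)) * x ^ Suc m"
    unfolding pderiv_legendre_at[OF assms] Suc.IH by (simp add: algebra_simps)
  finally show ?case
    unfolding mult_cancel_left of_nat_eq_0_iff by simp
qed simp

text \<open>
  By the differential equation and the derivative recurrence, both sides have the same derivative,
  and they agree at \<open>1\<close>.
\<close>

lemma legendre_Suc:
  "real (Suc m) * poly (legendre (Suc m)) x =
     (x\<^sup>2 - 1) * poly (pderiv (legendre m)) x + real (Suc m) * x * poly (legendre m) x"
proof -
  define G where "G = smult (real (Suc m)) (legendre (Suc m))
    - (\<U> * pderiv (legendre m) + smult (real (Suc m)) (\<X> * legendre m))"
  have "poly (pderiv G) y = 0" for y
    using legendre_ode[of y m]
    unfolding G_def pderiv_diff pderiv_add pderiv_mult pderiv_smult pderiv_XU poly_diff poly_add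
      poly_mult poly_smult pderiv_legendre_Suc
    by (simp add: algebra_simps power2_eq_square)
  then have "pderiv G = 0" using poly_all_0_iff_0 by blast
  then obtain c where "G = [:c:]" using pderiv_iszero by blast
  moreover have "poly G 1 = 0" by (simp add: G_def legendre_at_unit)
  ultimately have "poly G x = 0" by simp
  then show ?thesis by (simp add: G_def algebra_simps power2_eq_square)
qed

lemma x_pderiv_legendre_Suc:
  "x * poly (pderiv (legendre (Suc m))) x =
     poly (pderiv (legendre m)) x + real (Suc m) * poly (legendre (Suc m)) x"
  unfolding legendre_Suc pderiv_legendre_Suc by (simp add: algebra_simps power2_eq_square)

lemma degree_legendre: "degree (legendre m) = m"
  by (simp add: legendre_def degree_higher_pderiv degree_power_eq)

lemma coeff_legendre_Suc:
  "real (Suc m) * coeff (legendre (Suc m)) (Suc m) = real (2 * m + 1) * coeff (legendre m) m"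
proof -
  have "pderiv (legendre (Suc m)) = \<X> * pderiv (legendre m) + smult (real (Suc m)) (legendre m)"
    by (rule poly_eqI_poly) (simp add: pderiv_legendre_Suc)
  then have "coeff (pderiv (legendre (Suc m))) m =
      coeff (\<X> * pderiv (legendre m)) m + real (Suc m) * coeff (legendre m) m"
    by simp
  moreover have "coeff (\<X> * pderiv (legendre m)) m = real m * coeff (legendre m) m"
    by (cases m) (simp_all add: coeff_pderiv)
  ultimately show ?thesis by (simp add: coeff_pderiv algebra_simps)
qed

text \<open>
  The differential equation is the eigenvalue equation \<open>((x^2 - 1) P')' = k (k + 1) P\<close> of a
  symmetric operator: \<open>(x^2 - 1) (P_j' P_k - P_k' P_j)\<close> vanishes at both end points, and its
  derivative is the difference of the two eigenvalues times \<open>P_j P_k\<close>.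
\<close>

lemma poly_integral_legendre_neq:
  assumes "j \<noteq> k"
  shows "poly_integral (legendre j * legendre k) = 0"
proof -
  let ?F = "\<U> * (pderiv (legendre j) * legendre k - pderiv (legendre k) * legendre j)"
  let ?c = "real (j * (j + 1)) - real (k * (k + 1))"
  have "poly (pderiv ?F) x = poly (smult ?c (legendre j * legendre k)) x" for x
  proof -
    have "poly (pderiv ?F) x =
      ((x\<^sup>2 - 1) * poly (pderiv (pderiv (legendre j))) x + 2 * x * poly (pderiv (legendre j)) x) * poly (legendre k) x
      - ((x\<^sup>2 - 1) * poly (pderiv (pderiv (legendre k))) x + 2 * x * poly (pderiv (legendre k)) x) * poly (legendre j) x"
      unfolding pderiv_diff pderiv_mult pderiv_XU poly_diff poly_add poly_mult
      by (simp add: algebra_simps power2_eq_square)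
    then show ?thesis by (simp only: legendre_ode) (simp add: algebra_simps)
  qed
  then have "pderiv ?F = smult ?c (legendre j * legendre k)" by (rule poly_eqI_poly)
  then have "?c * poly_integral (legendre j * legendre k) = poly ?F 1 - poly ?F (- 1)"
    by (metis poly_integral_pderiv poly_integral_smult)
  moreover have "?c \<noteq> 0"
  proof -
    have "?c = (real j - real k) * (real j + real k + 1)" by (simp add: algebra_simps)
    with assms show ?thesis by simp
  qed
  ultimately show ?thesis by simp
qed

text \<open>
  There is a Legendre polynomial of each degree, so subtracting multiples of them reduces the
  degree of \<open>q\<close> step by step.
\<close>

lemma poly_integral_legendre_less:
  assumes "degree q < k"
  shows "poly_integral (legendre k * q) = 0"
  using assms
proof (induction "degree q" arbitrary: q rule: less_induct)
  case less
  define d where "d = degree q"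
  define c where "c = lead_coeff q / coeff (legendre d) d"
  define r where "r = q - smult c (legendre d)"
  have lc: "coeff (legendre d) d \<noteq> 0"
    by (metis degree_legendre leading_coeff_0_iff degree_0 legendre_0 one_neq_zero)
  have q: "q = smult c (legendre d) + r" by (simp add: r_def)
  have "poly_integral (legendre k * r) = 0"
  proof (cases "r = 0")
    case False
    have "degree r \<le> d"
      unfolding r_def by (intro degree_diff_le) (simp_all add: d_def degree_legendre)
    moreover have "coeff r d = 0"
      using lc by (simp add: r_def c_def d_def)
    ultimately have "degree r < d"
      using False by (metis leading_coeff_0_iff order_le_less)
    then show ?thesis using less by (simp add: d_def)
  qed simp
  moreover have "poly_integral (legendre k * legendre d) = 0"
    using less.prems by (intro poly_integral_legendre_neq) (simp add: d_def)
  ultimately show ?case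
    by (subst q) (simp add: distrib_left poly_integral_add poly_integral_smult)
qed

text \<open>
  Integrate the derivative of \<open>x P_k^2\<close>. In \<open>x P_k' = P_(k-1)' + k P_k\<close> the term
  \<open>P_(k-1)'\<close> has too small a degree to contribute, so that only multiples of the wanted
  integral remain.
\<close>

lemma poly_integral_legendre_square:
  "poly_integral (legendre k * legendre k) = 2 / (2 * real k + 1)"
proof -
  have "poly_integral (\<X> * pderiv (legendre k) * legendre k) = real k * poly_integral (legendre k * legendre k)"
  proof (cases k)
    case (Suc m)
    have "poly (\<X> * pderiv (legendre k) * legendre k) x
      = poly (legendre k * pderiv (legendre m) + smult (real k) (legendre k * legendre k)) x" for x
    proof -
      have "poly (\<X> * pderiv (legendre k) * legendre k) x
          = (x * poly (pderiv (legendre k)) x) * poly (legendre k) x" by simp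
      then show ?thesis unfolding Suc x_pderiv_legendre_Suc by (simp add: algebra_simps)
    qed
    then have "\<X> * pderiv (legendre k) * legendre k
        = legendre k * pderiv (legendre m) + smult (real k) (legendre k * legendre k)"
      by (rule poly_eqI_poly)
    moreover have "poly_integral (legendre k * pderiv (legendre m)) = 0"
      using Suc by (intro poly_integral_legendre_less) (simp add: degree_pderiv degree_legendre)
    ultimately show ?thesis by (simp only: poly_integral_add poly_integral_smult)
  qed simp
  moreover have "pderiv (\<X> * (legendre k * legendre k))
      = legendre k * legendre k + smult 2 (\<X> * pderiv (legendre k) * legendre k)"
    unfolding pderiv_mult pderiv_XU
    by (rule poly_eqI_poly) (simp add: algebra_simps)
  ultimately have "(2 * real k + 1) * poly_integral (legendre k * legendre k) = 2"
    using poly_integral_pderiv[of "\<X> * (legendre k * legendre k)"]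
    by (simp only: poly_integral_add poly_integral_smult) (simp add: legendre_at_unit power_mult_distrib[symmetric] algebra_simps)
  then show ?thesis by (simp add: field_simps)
qed

section \<open>Roots of the Radau polynomial\<close>

lemma legendre_sum_eq_radau_poly:
  "legendre n + legendre (Suc n) = [:1, 1:] * radau_poly (Suc n)"
proof -
  have "poly (legendre n + legendre (Suc n)) (- 1) = 0"
    by (simp add: legendre_at_unit)
  then have "[:- (- 1), 1:] dvd legendre n + legendre (Suc n)"
    unfolding poly_eq_0_iff_dvd .
  then have "[:1, 1:] dvd legendre n + legendre (Suc n)" by simp
  then show ?thesis
    by (simp add: radau_poly_def del: mult_pCons_left)
qed

lemma degree_legendre_sum: "degree (legendre n + legendre (Suc n)) = Suc n"
  by (simp add: degree_add_eq_right degree_legendre)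

lemma radau_poly_nonzero [simp]: "radau_poly (Suc n) \<noteq> 0"
  using degree_legendre_sum[of n] unfolding legendre_sum_eq_radau_poly by auto

lemma degree_radau_poly: "degree (radau_poly (Suc n)) = n"
proof -
  have "degree ([:1, 1:] * radau_poly (Suc n)) = 1 + degree (radau_poly (Suc n))"
    by (subst degree_mult_eq) auto
  then show ?thesis
    using degree_legendre_sum[of n] unfolding legendre_sum_eq_radau_poly by linarith
qed

lemma poly_integral_legendre_sum_times:
  assumes "degree q < n"
  shows "poly_integral ((legendre n + legendre (Suc n)) * q) = 0"
  using assms by (simp add: distrib_right poly_integral_add poly_integral_legendre_less)

text \<open>
  The source of all information on the roots. The Radau polynomial \<open>Q\<close> is orthogonal, for the weight
  \<open>1 + x\<close>, to all polynomials of smaller degree. If \<open>h\<close> were not constant, \<open>g\<close> would be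
  such a polynomial, but the integral of \<open>(1 + x) Q g = (1 + x) h g^2\<close> is positive.
\<close>

lemma radau_poly_factor_nonneg:
  assumes "radau_poly (Suc n) = g * h" "\<And>x. x \<in> {-1..1} \<Longrightarrow> poly h x \<ge> 0"
  shows "degree h = 0"
proof (rule ccontr)
  assume "degree h \<noteq> 0"
  have nz: "g * h \<noteq> 0" using assms(1) radau_poly_nonzero[of n] by simp
  then have "degree g + degree h = n"
    using assms(1) degree_radau_poly[of n] by (simp add: degree_mult_eq)
  with \<open>degree h \<noteq> 0\<close> have "degree g < n" by simp
  then have "poly_integral ([:1, 1:] * h * g * g) = 0"
    using poly_integral_legendre_sum_times[of g n]
    unfolding legendre_sum_eq_radau_poly assms(1) by (simp only: mult_ac)
  moreover have "poly_integral ([:1, 1:] * h * g * g) > 0"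
  proof (rule poly_integral_pos)
    fix x :: real assume x: "x \<in> {-1..1}"
    have "poly ([:1, 1:] * h * g * g) x = (1 + x) * poly h x * (poly g x)\<^sup>2"
      by (simp add: algebra_simps power2_eq_square)
    also have "\<dots> \<ge> 0" using x assms(2)[OF x] by simp
    finally show "poly ([:1, 1:] * h * g * g) x \<ge> 0" .
  next
    show "[:1, 1:] * h * g * g \<noteq> 0"
      using nz unfolding mult_eq_0_iff by simp
  qed
  ultimately show False by simp
qed

lemma radau_poly_root_bounds:
  assumes "poly (radau_poly (Suc n)) z = 0"
  shows "- 1 < z \<and> z < 1"
proof -
  obtain g where g: "radau_poly (Suc n) = [:- z, 1:] * g"
    using assms by (auto simp: poly_eq_0_iff_dvd elim: dvdE)
  have "\<not> z \<le> - 1"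
    using radau_poly_factor_nonneg[of n g "[:- z, 1:]"] g by (auto simp: mult.commute)
  moreover have "\<not> 1 \<le> z"
    using radau_poly_factor_nonneg[of n "- g" "[:z, - 1:]"] g by auto
  ultimately show ?thesis by simp
qed

lemma radau_poly_root_simple: "\<not> [:- z, 1:] * [:- z, 1:] dvd radau_poly (Suc n)"
proof
  assume "[:- z, 1:] * [:- z, 1:] dvd radau_poly (Suc n)"
  then obtain g where "radau_poly (Suc n) = g * ([:- z, 1:] * [:- z, 1:])"
    by (metis dvdE mult.commute)
  then have "degree ([:- z, 1:] * [:- z, 1:]) = 0"
  proof (rule radau_poly_factor_nonneg)
    fix x :: real
    have "poly ([:- z, 1:] * [:- z, 1:]) x = (x - z)\<^sup>2"
      by (simp add: algebra_simps power2_eq_square)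
    then show "poly ([:- z, 1:] * [:- z, 1:]) x \<ge> 0" by simp
  qed
  moreover have "degree ([:- z, 1:] * [:- z, 1:]) = 2"
    by (subst degree_mult_eq) auto
  ultimately show False by simp
qed

lemma poly_no_root_sign:
  fixes h :: "real poly"
  assumes "\<And>x. poly h x \<noteq> 0"
  shows "(\<forall>x. poly h x \<ge> 0) \<or> (\<forall>x. poly h x \<le> 0)"
proof (rule ccontr)
  assume "\<not> ?thesis"
  then obtain a b where ab: "poly h a < 0" "0 < poly h b" by (auto simp: not_le)
  then have "a \<noteq> b" by auto
  then show False
    using ab assms poly_IVT_pos[of a b h] poly_IVT_neg[of b a h] by (metis linorder_less_linear)
qed

abbreviation radau_roots :: "nat \<Rightarrow> real set" where
  "radau_roots n \<equiv> {x. poly (radau_poly (Suc n)) x = 0}"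

lemma finite_radau_roots: "finite (radau_roots n)"
  by (simp add: poly_roots_finite)

text \<open>
  Divide the Radau polynomial by one linear factor for each of its real roots. As these are simple,
  the quotient has no real root and so a constant sign on the line; hence it is constant.
\<close>

lemma card_radau_roots: "card (radau_roots n) = n"
proof -
  obtain h where h: "radau_poly (Suc n) = nodal_poly (radau_roots n) * h"
    using nodal_poly_dvd[OF finite_radau_roots, of n "radau_poly (Suc n)"] by (auto elim: dvdE)
  have "poly h x \<noteq> 0" for x
  proof
    assume "poly h x = 0"
    then have "poly (radau_poly (Suc n)) x = 0" by (subst h) simp
    then have x: "x \<in> radau_roots n" by simp
    have "[:- x, 1:] dvd h" using \<open>poly h x = 0\<close> by (simp add: poly_eq_0_iff_dvd)
    moreover have "[:- x, 1:] dvd nodal_poly (radau_roots n)"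
      using nodal_poly_remove[OF finite_radau_roots x] by (metis dvd_triv_left)
    ultimately have "[:- x, 1:] * [:- x, 1:] dvd radau_poly (Suc n)"
      by (subst h) (intro mult_dvd_mono)
    then show False using radau_poly_root_simple by blast
  qed
  then have "degree h = 0"
    using poly_no_root_sign[of h] radau_poly_factor_nonneg[of n "nodal_poly (radau_roots n)" h]
      radau_poly_factor_nonneg[of n "- nodal_poly (radau_roots n)" "- h"] h by auto
  moreover have "h \<noteq> 0" using h radau_poly_nonzero[of n] by auto
  ultimately have "degree (radau_poly (Suc n)) = card (radau_roots n)"
    by (subst h) (simp add: degree_mult_eq degree_nodal_poly)
  then show ?thesis by (simp add: degree_radau_poly)
qed

section \<open>Exactness and weights of the Radau quadrature\<close>

definition radau_nodes :: "nat \<Rightarrow> real set" where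
  "radau_nodes n = insert (- 1) (radau_roots n)"

lemma minus_one_notin_radau_roots: "- 1 \<notin> radau_roots n"
  using radau_poly_root_bounds[of n "- 1"] by auto

lemma finite_radau_nodes [simp]: "finite (radau_nodes n)"
  by (simp add: radau_nodes_def finite_radau_roots)

lemma card_radau_nodes: "card (radau_nodes n) = Suc n"
  using minus_one_notin_radau_roots[of n]
  by (simp add: radau_nodes_def finite_radau_roots card_radau_roots)

lemma legendre_sum_at_node: "x \<in> radau_nodes n \<Longrightarrow> poly (legendre n + legendre (Suc n)) x = 0"
  unfolding legendre_sum_eq_radau_poly by (auto simp: radau_nodes_def)

lemma legendre_sum_eq_nodal:
  "legendre n + legendre (Suc n) =
     smult (coeff (legendre (Suc n)) (Suc n)) (nodal_poly (radau_nodes n))"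
proof -
  let ?S = "legendre n + legendre (Suc n)" and ?M = "nodal_poly (radau_nodes n)"
  obtain h where h: "?S = ?M * h"
    using nodal_poly_dvd[OF finite_radau_nodes, of n ?S] legendre_sum_at_node by (auto elim: dvdE)
  have nz: "?S \<noteq> 0" using degree_legendre_sum[of n] by auto
  then have "h \<noteq> 0" using h by auto
  then have "degree ?S = Suc n + degree h"
    by (subst h) (simp add: degree_mult_eq degree_nodal_poly card_radau_nodes)
  then have "degree h = 0" using degree_legendre_sum[of n] by simp
  then obtain c where "h = [:c:]" by (auto elim: degree_eq_zeroE)
  then have S: "?S = smult c ?M" using h by simp
  have "coeff ?M (Suc n) = 1"
    using coeff_nodal_poly[of "radau_nodes n"] by (simp add: card_radau_nodes)
  then have "coeff ?S (Suc n) = c" unfolding S by simp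
  then have "c = coeff (legendre (Suc n)) (Suc n)" by (simp add: coeff_eq_0 degree_legendre)
  then show ?thesis using S by simp
qed

text \<open>
  As in Gauss quadrature: \<open>p\<close> minus its interpolant at the nodes is a multiple of the node
  polynomial, which is a multiple of \<open>P_n + P_(n+1)\<close>, with a cofactor of degree less than
  \<open>n\<close>. So the difference has integral zero. This gives exactness with weights in integral form;
  the weights remain to be computed.
\<close>

lemma poly_integral_eq_lagrange_sum:
  assumes "degree p \<le> 2 * n"
  shows "poly_integral p = (\<Sum>i\<in>radau_nodes n. poly p i * poly_integral (lagrange_basis (radau_nodes n) i))"
proof -
  let ?N = "radau_nodes n"
  let ?r = "interpolant (poly p) ?N"
  have "nodal_poly ?N dvd p - ?r"
    by (rule nodal_poly_dvd) (simp_all add: poly_interpolant)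
  then obtain q where q: "p - ?r = nodal_poly ?N * q" by (elim dvdE)
  have "poly_integral (nodal_poly ?N * q) = 0"
  proof (cases "q = 0")
    case False
    have "degree (p - ?r) \<le> 2 * n"
      using assms degree_interpolant[of ?N n "poly p"]
      by (intro degree_diff_le) (simp_all add: card_radau_nodes)
    then have "Suc n + degree q \<le> 2 * n"
      using False unfolding q by (simp add: degree_mult_eq degree_nodal_poly card_radau_nodes)
    then have "poly_integral ((legendre n + legendre (Suc n)) * q) = 0"
      by (intro poly_integral_legendre_sum_times) simp
    moreover have "coeff (legendre (Suc n)) (Suc n) \<noteq> 0"
      by (metis degree_legendre leading_coeff_0_iff degree_0 nat.distinct(1))
    ultimately show ?thesis
      unfolding legendre_sum_eq_nodal by (simp add: poly_integral_smult)
  qed simp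
  moreover have "p = ?r + nodal_poly ?N * q" using q by (simp add: algebra_simps)
  then have "poly_integral p = poly_integral ?r + poly_integral (nodal_poly ?N * q)" using poly_integral_add by metis
  ultimately show ?thesis
    by (simp add: interpolant_def poly_integral_sum poly_integral_smult)
qed

text \<open>
  Up to terms of smaller degree, \<open>q\<close> is \<open>P_n\<close> divided by its leading
  coefficient. Consecutive leading coefficients have the ratio \<open>(2 n + 1) / (n + 1)\<close>, which
  cancels the denominator of the integral of \<open>P_n^2\<close>.
\<close>

lemma poly_integral_monic_times_legendre:
  assumes "degree q \<le> n" "coeff q n = 1"
  shows "coeff (legendre (Suc n)) (Suc n) * poly_integral (q * legendre n) = 2 / real (Suc n)"
proof -
  let ?a = "coeff (legendre n) n"
  have a: "?a \<noteq> 0"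
    by (metis degree_legendre leading_coeff_0_iff degree_0 legendre_0 one_neq_zero)
  define r where "r = q - smult (1 / ?a) (legendre n)"
  have q: "q = smult (1 / ?a) (legendre n) + r" by (simp add: r_def)
  have "poly_integral (legendre n * r) = 0"
  proof (cases "r = 0")
    case False
    have "degree r \<le> n"
      unfolding r_def using assms by (intro degree_diff_le) (simp_all add: degree_legendre)
    moreover have "coeff r n = 0" using a assms by (simp add: r_def)
    ultimately have "degree r < n"
      using False by (metis leading_coeff_0_iff order_le_less)
    then show ?thesis by (rule poly_integral_legendre_less)
  qed simp
  then have "poly_integral (legendre n * q) = 1 / ?a * (2 / (2 * real n + 1))"
    by (subst q) (simp add: distrib_left poly_integral_add poly_integral_smult poly_integral_legendre_square)
  then have poly_integral: "poly_integral (q * legendre n) = 1 / ?a * (2 / (2 * real n + 1))"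
    by (simp only: mult.commute)
  have "coeff (legendre (Suc n)) (Suc n) = (2 * real n + 1) * ?a / real (Suc n)"
    using coeff_legendre_Suc[of n] by (simp add: field_simps)
  then show ?thesis
    unfolding poly_integral using a by (simp add: divide_simps)
qed

text \<open>
  Apply exactness to \<open>(P_n + P_(n+1)) / (x - i)\<close> times \<open>P_n\<close>. It has degree
  \<open>2 n\<close>, the only node at which it can be nonzero is \<open>i\<close>, and the value of the first factor there is
  the derivative of \<open>P_n + P_(n+1)\<close>.
\<close>

lemma radau_weight_identity:
  assumes "i \<in> radau_nodes n"
  shows "poly (pderiv (legendre n + legendre (Suc n))) i * poly (legendre n) i
           * poly_integral (lagrange_basis (radau_nodes n) i) = 2 / real (Suc n)"
proof -
  let ?N = "radau_nodes n" and ?c = "coeff (legendre (Suc n)) (Suc n)"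
  let ?M = "nodal_poly (?N - {i})"
  have card: "card (?N - {i}) = n" using assms by (simp add: card_radau_nodes)
  have "legendre n + legendre (Suc n) = [:- i, 1:] * smult ?c ?M"
    unfolding legendre_sum_eq_nodal by (subst nodal_poly_remove[OF _ assms]) simp_all
  then have deriv: "poly (pderiv (legendre n + legendre (Suc n))) i = ?c * poly ?M i"
    by (simp add: pderiv_mult pderiv_smult pderiv_pCons del: mult_pCons_left)
  have "degree (?M * legendre n) \<le> n + n"
    using degree_mult_le[of ?M "legendre n"] by (simp add: degree_nodal_poly card degree_legendre)
  then have "poly_integral (?M * legendre n) = (\<Sum>j\<in>?N. poly (?M * legendre n) j * poly_integral (lagrange_basis ?N j))"
    by (intro poly_integral_eq_lagrange_sum) simp
  also have "\<dots> = (\<Sum>j\<in>{i}. poly (?M * legendre n) j * poly_integral (lagrange_basis ?N j))"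
    using assms by (intro sum.mono_neutral_right) (auto simp: poly_nodal_poly)
  finally have "poly_integral (?M * legendre n) = poly ?M i * poly (legendre n) i * poly_integral (lagrange_basis ?N i)"
    by simp
  moreover have "?c * poly_integral (?M * legendre n) = 2 / real (Suc n)"
    using coeff_nodal_poly[of "?N - {i}"]
    by (intro poly_integral_monic_times_legendre) (simp_all add: card degree_nodal_poly)
  ultimately show ?thesis by (simp add: deriv mult.assoc)
qed

lemma radau_weight_minus_one:
  "poly_integral (lagrange_basis (radau_nodes n) (- 1)) = 2 / (real (Suc n))\<^sup>2"
proof -
  have "poly (pderiv (legendre n + legendre (Suc n))) (- 1) = real (Suc n) * (- 1) ^ n"
    using pderiv_legendre_at[of "- 1" n] pderiv_legendre_at[of "- 1" "Suc n"]
    by (simp add: pderiv_add legendre_at_unit algebra_simps)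
  moreover have "- 1 \<in> radau_nodes n" by (simp add: radau_nodes_def)
  moreover have "(- 1 :: real) ^ n * (- 1) ^ n = 1" by (simp flip: power_mult_distrib)
  ultimately have "real (Suc n) * poly_integral (lagrange_basis (radau_nodes n) (- 1)) = 2 / real (Suc n)"
    using radau_weight_identity[of "- 1" n] by (simp add: legendre_at_unit mult.assoc del: of_nat_Suc)
  then show ?thesis by (simp add: field_simps power2_eq_square del: of_nat_Suc)
qed

lemma radau_weight_root:
  assumes "z \<in> radau_roots n"
  shows "poly_integral (lagrange_basis (radau_nodes n) z) = 1 / ((1 - z) * (poly (pderiv (legendre n)) z)\<^sup>2)"
proof -
  define a where "a = poly (pderiv (legendre n)) z"
  define b where "b = poly (legendre n) z"
  define w where "w = poly_integral (lagrange_basis (radau_nodes n) z)"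
  have z: "z \<in> radau_nodes n" "- 1 < z" "z < 1"
    using assms radau_poly_root_bounds[of n z] by (auto simp: radau_nodes_def)
  \<comment> \<open>As \<open>P_n\<close> and \<open>P_(n+1)\<close> have opposite values at \<open>z\<close>, the two recurrences
      express both derivatives there by \<open>b\<close>.\<close>
  have "poly (legendre (Suc n)) z = - b"
    using legendre_sum_at_node[OF z(1)] by (simp add: b_def)
  then have "(1 + z) * ((1 - z) * a) = (1 + z) * (real (Suc n) * b)"
    using legendre_Suc[of n z] by (simp add: a_def b_def algebra_simps power2_eq_square)
  then have ab: "(1 - z) * a = real (Suc n) * b" using z by simp
  have "poly (pderiv (legendre (Suc n))) z = a"
    using ab pderiv_legendre_Suc[of n z] by (simp add: a_def b_def algebra_simps)
  then have "2 * a * b * w = 2 / real (Suc n)"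
    using radau_weight_identity[OF z(1)] by (simp add: pderiv_add a_def b_def w_def del: of_nat_Suc)
  then have "a * (real (Suc n) * b) * w = 1" by (simp add: field_simps del: of_nat_Suc)
  then have "(1 - z) * a\<^sup>2 * w = 1" unfolding ab[symmetric] by (simp add: algebra_simps power2_eq_square)
  then show ?thesis unfolding a_def[symmetric] w_def[symmetric]
    by (metis mult_zero_left nonzero_eq_divide_eq mult.commute zero_neq_one)
qed

lemma radau_left_eq_lagrange_sum:
  "radau_left (Suc n) f = (\<Sum>i\<in>radau_nodes n. f i * poly_integral (lagrange_basis (radau_nodes n) i))"
proof -
  have "(\<Sum>i\<in>radau_nodes n. f i * poly_integral (lagrange_basis (radau_nodes n) i)) =
    f (- 1) * poly_integral (lagrange_basis (radau_nodes n) (- 1))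
    + (\<Sum>i\<in>radau_roots n. f i * poly_integral (lagrange_basis (radau_nodes n) i))"
    using minus_one_notin_radau_roots[of n]
    by (subst radau_nodes_def, subst sum.insert) (simp_all add: finite_radau_roots)
  also have "\<dots> = radau_left (Suc n) f"
    unfolding radau_left_def radau_weight_minus_one
    by (auto simp: radau_weight_root intro!: sum.cong)
  finally show ?thesis by simp
qed

lemma radau_left_exact:
  assumes "degree p \<le> 2 * n"
  shows "radau_left (Suc n) (poly p) = poly_integral p"
  using poly_integral_eq_lagrange_sum[OF assms] by (simp add: radau_left_eq_lagrange_sum)

lemma radau_left_cong:
  assumes "\<And>x. x \<in> radau_nodes n \<Longrightarrow> f x = g x"
  shows "radau_left (Suc n) f = radau_left (Suc n) g"
  using assms by (simp add: radau_left_eq_lagrange_sum)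

section \<open>Radau quadrature bounds positive functionals\<close>

text \<open>
  If \<open>f\<close> were smooth, its Hermite interpolant at \<open>-1\<close> and doubly at the points of
  \<open>Z\<close> would lie below \<open>f\<close>. Splitting each double node into \<open>z\<close> and
  \<open>z + \<epsilon>\<close> avoids derivatives: outside the gaps between \<open>z\<close> and \<open>z + \<epsilon>\<close> the sign of the
  error is right. In a gap the error has the factors \<open>x - z\<close> and \<open>x - (z + \<epsilon>)\<close>,
  of product \<open>O(\<epsilon>^2)\<close>, while \<open>\<epsilon>\<close> times the divided difference with \<open>2 n + 2\<close> nodes is a difference
  of two with \<open>2 n + 1\<close> nodes. Those are bounded independently of \<open>\<epsilon>\<close>, because they
  are monotone in the nodes. So the error there is at worst \<open>O(\<epsilon>)\<close>.
\<close>

lemma near_double_interpolant_below: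
  assumes "n \<ge> 1" and Z: "finite Z" "card Z = n" "Z \<subseteq> {-1<..<1}"
    and f: "m_convex_on (2 * n) {-1..1} f"
  obtains C \<delta> where "C \<ge> 0" "\<delta> > 0"
    "\<And>\<epsilon>. 0 < \<epsilon> \<Longrightarrow> \<epsilon> < \<delta> \<Longrightarrow> \<exists>p. degree p \<le> 2 * n \<and> (\<forall>t\<in>insert (-1) Z. poly p t = f t) \<and>
       (\<forall>x\<in>{-1..1}. poly p x - C * \<epsilon> \<le> f x)"
proof -
  have "Z \<noteq> {}" using assms by auto
  define a where "a = Min Z"
  define b where "b = (Max Z + 1) / 2"
  have "Min Z \<in> Z" "Max Z \<in> Z" using Z \<open>Z \<noteq> {}\<close> by auto
  then have ab: "- 1 < a" "b < 1" "Max Z < b"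
    using Z by (auto simp: a_def b_def)
  have Zab: "a \<le> z \<and> z \<le> Max Z" if "z \<in> Z" for z
    using Z that by (simp add: a_def)
  \<comment> \<open>The sets \<open>V\<close> and \<open>V'\<close> lie to the right and to the left of all nodes but
      \<open>-1\<close>, so that they bound the divided differences by monotonicity.\<close>
  obtain V where V: "finite V" "card V = 2 * n" "V \<subseteq> {b<..<1}"
    using infinite_arbitrarily_large[OF infinite_Ioo[OF ab(2)]] by blast
  obtain V' where V': "finite V'" "card V' = 2 * n" "V' \<subseteq> {-1<..<a}"
    using infinite_arbitrarily_large[OF infinite_Ioo[OF ab(1)]] by blast
  have "a \<le> b" using Zab[OF \<open>Max Z \<in> Z\<close>] ab(3) by linarith
  define L where "L = divided_diff_set f (insert (-1) V')"
  define U where "U = divided_diff_set f (insert (-1) V)"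
  have bounds: "L \<le> divided_diff_set f (insert (-1) S)" "divided_diff_set f (insert (-1) S) \<le> U"
    if S: "finite S" "card S = 2 * n" "S \<subseteq> {a..b}" for S
  proof -
    have V'_range: "- 1 < v \<and> v < a" if "v \<in> V'" for v using V'(3) that by auto
    have V_range: "b < v \<and> v < 1" if "v \<in> V" for v using V(3) that by auto
    have S_range: "a \<le> s \<and> s \<le> b" if "s \<in> S" for s using S(3) that by auto
    have "divided_diff_set f ({-1} \<union> V') \<le> divided_diff_set f ({-1} \<union> S)"
    proof (rule divided_diff_set_mono[OF f])
      show "card ({-1} \<union> V') = 2 * n + 1" using V'(1,2) V'_range[of "-1"] by (auto simp: card_insert_if)
      show "{-1} \<inter> V' = {}" using V'_range[of "-1"] by auto
      show "{-1} \<inter> S = {}" using S_range[of "-1"] ab by auto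
      show "{-1} \<union> V' \<union> S \<subseteq> {-1..1}"
        using V'_range S_range ab \<open>a \<le> b\<close> by (fastforce intro: order_trans less_imp_le)
      show "s < v" if "s \<in> V'" "v \<in> S" for s v
        using V'_range[OF that(1)] S_range[OF that(2)] by linarith
    qed (use S V' in auto)
    then show "L \<le> divided_diff_set f (insert (-1) S)" by (simp add: L_def)
    have "divided_diff_set f ({-1} \<union> S) \<le> divided_diff_set f ({-1} \<union> V)"
    proof (rule divided_diff_set_mono[OF f])
      show "card ({-1} \<union> S) = 2 * n + 1" using S(1,2) S_range[of "-1"] ab by (auto simp: card_insert_if)
      show "{-1} \<inter> V = {}" using V_range[of "-1"] ab \<open>a \<le> b\<close> by auto
      show "{-1} \<inter> S = {}" using S_range[of "-1"] ab by auto
      show "{-1} \<union> S \<union> V \<subseteq> {-1..1}"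
        using V_range S_range ab \<open>a \<le> b\<close> by (fastforce intro: order_trans less_imp_le)
      show "s < v" if "s \<in> S" "v \<in> V" for s v
        using S_range[OF that(1)] V_range[OF that(2)] by linarith
    qed (use S V in auto)
    then show "divided_diff_set f (insert (-1) S) \<le> U" by (simp add: U_def)
  qed
  \<comment> \<open>For \<open>\<epsilon>\<close> below the least distance of two points of \<open>Z\<close>, no
      shifted point falls on a point of \<open>Z\<close>.\<close>
  define D where "D = insert 1 ((\<lambda>(y, z). \<bar>y - z\<bar>) ` (Z \<times> Z) - {0})"
  have D: "finite D" "D \<noteq> {}" "\<And>d. d \<in> D \<Longrightarrow> d > 0"
    using Z by (auto simp: D_def)
  define \<delta> where "\<delta> = min (Min D) (b - Max Z)"
  \<comment> \<open>The power of two bounds the product of the distances to the nodes outside the gap, as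
      distances in \<open>{-1..1}\<close> are at most 2.\<close>
  define C where "C = \<bar>U - L\<bar> * 2 ^ (2 * n + 1)"
  show thesis
  proof (rule that)
    show "C \<ge> 0" by (simp add: C_def)
    show "\<delta> > 0" using D ab by (simp add: \<delta>_def)
    fix \<epsilon> :: real assume \<epsilon>: "0 < \<epsilon>" "\<epsilon> < \<delta>"
    define W where "W = Z \<union> (\<lambda>z. z + \<epsilon>) ` Z"
    have disj: "Z \<inter> (\<lambda>z. z + \<epsilon>) ` Z = {}"
    proof (rule ccontr)
      assume "Z \<inter> (\<lambda>z. z + \<epsilon>) ` Z \<noteq> {}"
      then obtain y z where yz: "y \<in> Z" "z \<in> Z" "y = z + \<epsilon>" by auto
      then have "\<epsilon> = (\<lambda>(y, z). \<bar>y - z\<bar>) (y, z)" using \<epsilon> by simp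
      then have "\<epsilon> \<in> D" using yz \<epsilon> unfolding D_def by blast
      then have "Min D \<le> \<epsilon>" using D by simp
      then show False using \<epsilon> by (simp add: \<delta>_def)
    qed
    have W: "finite W" "card W = 2 * n" "W \<subseteq> {a..b}"
    proof -
      show "finite W" using Z by (simp add: W_def)
      have "card ((\<lambda>z. z + \<epsilon>) ` Z) = n" using Z by (simp add: card_image)
      then show "card W = 2 * n" using Z disj by (simp add: W_def card_Un_disjoint)
      have "\<epsilon> < b - Max Z" using \<epsilon> by (simp add: \<delta>_def)
      then have "a \<le> z \<and> z + \<epsilon> \<le> b" if "z \<in> Z" for z
        using Zab[OF that] \<epsilon> by linarith
      then show "W \<subseteq> {a..b}" using \<epsilon> unfolding W_def by fastforce
    qed
    define p where "p = interpolant f (insert (-1) W)"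
    have W_range: "- 1 < t \<and> t < 1" if "t \<in> W" for t
      using that W(3) ab by fastforce
    then have "- 1 \<notin> W" by blast
    then have T: "finite (insert (-1) W)" "card (insert (-1) W) = 2 * n + 1" "insert (-1) W \<subseteq> {-1..1}"
      using W by (simp, simp, use W_range in fastforce)
    have p_eq: "poly p t = f t" if "t \<in> insert (-1) W" for t
      using that T by (simp add: p_def poly_interpolant)
    have below: "poly p x - C * \<epsilon> \<le> f x" if x: "x \<in> {-1..1}" for x
    proof (cases "x \<in> insert (-1) W")
      case True
      then show ?thesis using p_eq \<epsilon> by (simp add: C_def)
    next
      case False
      let ?\<omega> = "\<Prod>t\<in>insert (-1) W. x - t"
      have err: "f x - poly p x = divided_diff_set f (insert x (insert (-1) W)) * ?\<omega>"
        unfolding p_def by (rule interpolation_error[OF T(1) False])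
      have nonneg: "divided_diff_set f (insert x (insert (-1) W)) \<ge> 0"
        using f T False x unfolding m_convex_on_iff_divided_diff_set by auto
      show ?thesis
      proof (cases "\<exists>z\<in>Z. z < x \<and> x < z + \<epsilon>")
        case False
        \<comment> \<open>Outside all gaps, the two factors of each pair of nodes have the same sign.\<close>
        have "?\<omega> = (x + 1) * (\<Prod>z\<in>Z. (x - z) * (x - (z + \<epsilon>)))"
          using W \<open>- 1 \<notin> W\<close> Z disj
          by (simp add: W_def prod.union_disjoint prod.reindex prod.distrib)
        moreover have "(x - z) * (x - (z + \<epsilon>)) \<ge> 0" if "z \<in> Z" for z
        proof -
          have "\<not> (z < x \<and> x < z + \<epsilon>)" using False that by blast
          then show ?thesis using \<epsilon> unfolding zero_le_mult_iff by linarith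
        qed
        ultimately have "?\<omega> \<ge> 0" using x by (simp add: prod_nonneg)
        then have "f x - poly p x \<ge> 0" using nonneg unfolding err by simp
        moreover have "C * \<epsilon> \<ge> 0" using \<epsilon> by (simp add: C_def)
        ultimately show ?thesis by simp
      next
        case True
        then obtain z where z: "z \<in> Z" "z < x" "x < z + \<epsilon>" by blast
        define R where "R = W - {z, z + \<epsilon>}"
        have zW: "z \<in> W" "z + \<epsilon> \<in> W" using z by (auto simp: W_def)
        have R: "finite R" "z \<notin> R" "z + \<epsilon> \<notin> R" "x \<notin> R" "- 1 \<notin> R" "W = insert z (insert (z + \<epsilon>) R)"
          using W \<open>- 1 \<notin> W\<close> False zW by (auto simp: R_def)
        have cR: "card R + 2 = 2 * n" using W(2) R \<epsilon> by simp
        have ne: "x \<noteq> z" "x \<noteq> z + \<epsilon>" "x \<noteq> -1" "z \<noteq> -1" "z + \<epsilon> \<noteq> -1" "z \<noteq> z + \<epsilon>"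
          using z False \<open>- 1 \<notin> W\<close> zW \<epsilon> by auto
        have "insert x (insert (-1) W) = insert z (insert (z + \<epsilon>) (insert (-1) (insert x R)))"
          using R(6) by auto
        then have "divided_diff_set f (insert x (insert (-1) W)) * \<epsilon>
            = divided_diff_set f (insert (z + \<epsilon>) (insert (-1) (insert x R)))
              - divided_diff_set f (insert z (insert (-1) (insert x R)))"
          using divided_diff_set_recurrence[of "insert (-1) (insert x R)" z "z + \<epsilon>" f] R ne by simp
        also have "\<dots> = divided_diff_set f (insert (-1) (insert (z + \<epsilon>) (insert x R)))
             - divided_diff_set f (insert (-1) (insert z (insert x R)))"
          by (simp only: insert_commute)
        also have "\<dots> \<le> U - L"
        proof (rule diff_mono)
          have sub: "insert z (insert (z + \<epsilon>) (insert x R)) \<subseteq> {a..b}"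
          proof -
            have "a \<le> z" "z + \<epsilon> \<le> b" "R \<subseteq> {a..b}" using W(3) R(6) by auto
            then show ?thesis using z by auto
          qed
          show "divided_diff_set f (insert (-1) (insert (z + \<epsilon>) (insert x R))) \<le> U"
            using R ne cR sub by (intro bounds) auto
          show "L \<le> divided_diff_set f (insert (-1) (insert z (insert x R)))"
            using R ne cR sub by (intro bounds) auto
        qed
        finally have gap: "divided_diff_set f (insert x (insert (-1) W)) * \<epsilon> \<le> \<bar>U - L\<bar>" by linarith
        have "\<bar>?\<omega>\<bar> = \<bar>x - z\<bar> * \<bar>x - (z + \<epsilon>)\<bar> * (\<Prod>t\<in>insert (-1) R. \<bar>x - t\<bar>)"
        proof -
          have "insert (-1) W = insert z (insert (z + \<epsilon>) (insert (-1) R))" using R(6) by auto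
          then show ?thesis using R ne by (simp only:) (simp add: abs_mult abs_prod mult.assoc)
        qed
        also have "\<dots> \<le> \<epsilon> * \<epsilon> * 2 ^ (2 * n + 1)"
        proof -
          have "\<bar>x - t\<bar> \<le> 2" if "t \<in> insert (-1) R" for t
          proof -
            have "t \<in> {-1..1}" using T(3) R(6) that by blast
            then show ?thesis using x by (simp add: abs_if)
          qed
          then have "(\<Prod>t\<in>insert (-1) R. \<bar>x - t\<bar>) \<le> 2 ^ (2 * n + 1)"
            using R cR by (intro prod_le_power) auto
          moreover have "\<bar>x - z\<bar> * \<bar>x - (z + \<epsilon>)\<bar> \<le> \<epsilon> * \<epsilon>"
            using z by (intro mult_mono) auto
          ultimately show ?thesis
            by - (rule mult_mono, auto intro: prod_nonneg)
        qed
        finally have \<omega>: "\<bar>?\<omega>\<bar> \<le> \<epsilon> * \<epsilon> * 2 ^ (2 * n + 1)" .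
        let ?E = "divided_diff_set f (insert x (insert (-1) W))"
        have "poly p x - f x \<le> ?E * \<bar>?\<omega>\<bar>"
          using err nonneg abs_mult[of ?E ?\<omega>] by linarith
        also have "\<dots> \<le> ?E * (\<epsilon> * \<epsilon> * 2 ^ (2 * n + 1))"
          using \<omega> nonneg by (rule mult_left_mono)
        also have "\<dots> = (?E * \<epsilon>) * (2 ^ (2 * n + 1) * \<epsilon>)" by (simp only: mult_ac)
        also have "\<dots> \<le> \<bar>U - L\<bar> * (2 ^ (2 * n + 1) * \<epsilon>)"
          using gap \<epsilon> by (intro mult_right_mono) auto
        finally show ?thesis by (simp add: C_def mult_ac)
      qed
    qed
    have "degree p \<le> 2 * n"
      using degree_interpolant[OF T(1), of "2 * n" f] T(2) by (simp add: p_def)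
    with below p_eq show "\<exists>p. degree p \<le> 2 * n \<and> (\<forall>t\<in>insert (-1) Z. poly p t = f t) \<and>
       (\<forall>x\<in>{-1..1}. poly p x - C * \<epsilon> \<le> f x)"
      unfolding W_def by blast
  qed
qed

text \<open>
  The approximants of the previous lemma agree with \<open>f\<close> at the Radau nodes, so by exactness their
  integrals are \<open>radau_left (Suc n) f\<close>; lowering them by a constant that tends to zero brings them
  below \<open>f\<close>. With a number \<open>\<tau>\<close> in place of the value of a functional, the lemma
  also applies to \<open>x \<mapsto> - f (- x)\<close>, with \<open>\<tau> = - T f\<close>.
\<close>

lemma radau_left_le:
  assumes "n \<ge> 1" and f: "m_convex_on (2 * n) {-1..1} f"
    and \<tau>: "\<And>p. degree p \<le> 2 * n \<Longrightarrow> (\<And>x. x \<in> {-1..1} \<Longrightarrow> poly p x \<le> f x) \<Longrightarrow> poly_integral p \<le> \<tau>"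
  shows "radau_left (Suc n) f \<le> \<tau>"
proof (rule field_le_epsilon)
  fix e :: real assume "e > 0"
  have "radau_roots n \<subseteq> {-1<..<1}" using radau_poly_root_bounds by auto
  then obtain C \<delta> where C: "C \<ge> 0" "\<delta> > 0"
    and approx: "\<And>\<epsilon>. 0 < \<epsilon> \<Longrightarrow> \<epsilon> < \<delta> \<Longrightarrow> \<exists>p. degree p \<le> 2 * n \<and> (\<forall>t\<in>radau_nodes n. poly p t = f t) \<and>
       (\<forall>x\<in>{-1..1}. poly p x - C * \<epsilon> \<le> f x)"
    using near_double_interpolant_below[OF assms(1) finite_radau_roots card_radau_roots _ f]
    unfolding radau_nodes_def by metis
  define \<epsilon> where "\<epsilon> = min (\<delta> / 2) (e / (2 * C + 1))"
  have \<epsilon>: "0 < \<epsilon>" "\<epsilon> < \<delta>" using C \<open>e > 0\<close> by (auto simp: \<epsilon>_def)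
  have "\<epsilon> \<le> e / (2 * C + 1)" by (simp add: \<epsilon>_def)
  then have "\<epsilon> * (2 * C + 1) \<le> e" using C by (simp add: pos_le_divide_eq)
  then have e: "2 * (C * \<epsilon>) \<le> e" using \<epsilon> by (simp add: algebra_simps)
  obtain p where p: "degree p \<le> 2 * n" "\<And>t. t \<in> radau_nodes n \<Longrightarrow> poly p t = f t"
      "\<And>x. x \<in> {-1..1} \<Longrightarrow> poly p x - C * \<epsilon> \<le> f x"
    using approx[OF \<epsilon>] by auto
  have "poly_integral (p + [:- (C * \<epsilon>):]) \<le> \<tau>"
    using p by (intro \<tau> degree_add_le) auto
  moreover have "poly_integral [:- (C * \<epsilon>):] = - (2 * (C * \<epsilon>))"
    using integral_const_real[of "- (C * \<epsilon>)" "-1" 1]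
    by (simp add: poly_integral_def fun_eq_iff cong: integral_cong)
  moreover have "poly_integral p = radau_left (Suc n) f"
    using radau_left_exact[OF p(1)] radau_left_cong[of n "poly p" f] p(2) by simp
  ultimately show "radau_left (Suc n) f \<le> \<tau> + e"
    using e by (simp add: poly_integral_add)
qed

lemma poly_integral_reflect:
  fixes p :: "real poly"
  shows "poly_integral (pcompose p [:0, - 1:]) = poly_integral p"
proof -
  have "poly (pcompose p [:0, - 1:]) = (\<lambda>x. poly p (- x))" by (auto simp: poly_pcompose)
  then show ?thesis
    using Henstock_Kurzweil_Integration.integral_reflect_real[where f = "poly p" and a = "- 1" and b = 1]
    by (simp add: poly_integral_def)
qed

theorem theorem15:
  fixes n :: nat
    and X :: "(real \<Rightarrow> real) set"
    and T :: "(real \<Rightarrow> real) \<Rightarrow> real"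
    and f :: "real \<Rightarrow> real"
  assumes "n \<ge> 1"
    and "real_fun_span {g. m_convex_on (2 * n) {-1..1} g} \<subseteq> X"
    and "linear_functional_on X T"
    and "positive_functional_on X T"
    and "exact_on_polys (2 * n) T"
    and "m_convex_on (2 * n) {-1..1} f"
  shows "radau_left (n + 1) f \<le> T f \<and> T f \<le> radau_right (n + 1) f"
proof
  have in_X: "g \<in> X" if "m_convex_on (2 * n) {-1..1} g" for g
    using assms(2) that real_fun.span_base by fastforce
  have T_poly: "T (poly p) = poly_integral p" if "degree p \<le> 2 * n" for p
    using assms(5) that by (simp add: exact_on_polys_def poly_integral_def)
  have T_mono: "T g \<le> T h"
    if "m_convex_on (2 * n) {-1..1} g" "m_convex_on (2 * n) {-1..1} h" "\<And>x. x \<in> {-1..1} \<Longrightarrow> g x \<le> h x" for g h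
    using assms(4) in_X that unfolding positive_functional_on_def by blast
  have "radau_left (Suc n) f \<le> T f"
  proof (rule radau_left_le[OF assms(1,6)])
    fix p :: "real poly"
    assume p: "degree p \<le> 2 * n" "\<And>x. x \<in> {-1..1} \<Longrightarrow> poly p x \<le> f x"
    then have "T (poly p) \<le> T f"
      using assms(6) by (intro T_mono m_convex_on_poly)
    then show "poly_integral p \<le> T f" using p by (simp add: T_poly)
  qed
  then show "radau_left (n + 1) f \<le> T f" by simp
  \<comment> \<open>The upper bound is the lower bound for the reflected function.\<close>
  have "radau_left (Suc n) (\<lambda>x. - f (- x)) \<le> - T f"
  proof (rule radau_left_le[OF assms(1) m_convex_on_reflect[OF _ assms(6)]])
    fix p :: "real poly"
    assume p: "degree p \<le> 2 * n" "\<And>x. x \<in> {-1..1} \<Longrightarrow> poly p x \<le> - f (- x)"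
    define q where "q = smult (- 1) (pcompose p [:0, - 1:])"
    have q: "degree q \<le> 2 * n" using p(1) by (simp add: q_def degree_pcompose)
    have "f x \<le> poly q x" if "x \<in> {-1..1}" for x
      using p(2)[of "- x"] that by (simp add: q_def poly_pcompose)
    then have "T f \<le> T (poly q)"
      using assms(6) q by (intro T_mono m_convex_on_poly)
    also have "\<dots> = - poly_integral p"
      using T_poly[OF q] unfolding q_def poly_integral_smult poly_integral_reflect by simp
    finally show "poly_integral p \<le> - T f" by simp
  qed simp
  moreover have "radau_left (Suc n) (\<lambda>x. - f (- x)) = - radau_right (Suc n) f"
    by (simp add: radau_right_def radau_left_def sum_negf)
  ultimately show "T f \<le> radau_right (n + 1) f" by simp
qed

end
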